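(* Let $a\in\mathbb{N}$, $a\ge3$, $S=\langle a,a+1,a+2\rangle$ and $r\in\mathbb{N}$. The following are equivalent: (i) $r\in S$; (ii) $\varepsilon_r\le 2\ell_r$; (iii) $\phi_r\in\mathbb{N}^3$; (iv) there exist $u,v\in\mathbb{N}$ with $v\le 2u$ and $r=au+v$. In that case $\phi_r\in\operatorname{F}(r,S)$. Suppose moreover that $r\in S\cap\llbracket 0,\mathscr{L}_a)\!)$ (so that $\operatorname{L}(r,S)=\{\ell_r\}$). Then: (1) if $u,v\in\mathbb{N}$ satisfy $v\le 2u$ and $r=au+v$, then $(u,v)=(\ell_r,\varepsilon_r)$; (2) $\operatorname{F}(r,S)=\{\phi_r+j\omega:0\le j\le\kappa_r\}$; (3) $\mathcal{B}_r=\{\mathrm{m}^{\phi_r+j\omega}:0\le j\le\kappa_r\}$ is a basis of $W_r$; in particular $\delta_r=\kappa_r+1$; (4) $\ell_r=2(\delta_r-1)+\iota_r$; in particular $\ell_r$ and $\iota_r$ have the same parity and $0\le\iota_r\le\ell_r$.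
   Context: $\mathbb{N}=\{0,1,2,\dots\}$. $S=\langle a,a+1,a+2\rangle=\{\alpha_1a+\alpha_2(a+1)+\alpha_3(a+2):\alpha_i\in\mathbb{N}\}$. $\operatorname{F}(r,S)=\{\alpha\in\mathbb{N}^3:\alpha_1a+\alpha_2(a+1)+\alpha_3(a+2)=r\}$, $|\alpha|=\alpha_1+\alpha_2+\alpha_3$, $\operatorname{L}(r,S)=\{|\alpha|:\alpha\in\operatorname{F}(r,S)\}$. $\mathscr{L}_a=\lfloor a/2\rfloor (a+2)$ if $a$ is even, and $\mathscr{L}_a=(\lfloor a/2\rfloor+2)a$ if $a$ is odd; $\llbracket x,y)\!)=\{n\in\mathbb{Z}:x\le n<y\}$. For $r\in\mathbb{N}$: $\ell_r=\lfloor r/a\rfloor$, $\varepsilon_r=r-a\ell_r$ (remainder of $r$ mod $a$), and the seed vector $\phi_r=(\phi_{r,1},\phi_{r,2},\phi_{r,3})=(\ell_r-\lfloor(\varepsilon_r+1)/2\rfloor,\ \varepsilon_r-2\lfloor\varepsilon_r/2\rfloor,\ \lfloor\varepsilon_r/2\rfloor)\in\mathbb{Z}^3$. When $\phi_r\in\mathbb{N}^3$: $\kappa_r=\min(\phi_{r,1},\phi_{r,3})$ and $\iota_r=\phi_{r,2}+|\phi_{r,1}-\phi_{r,3}|$. $\omega=(-1,2,-1)$. Let $\mathbb{K}$ be a field and $x,y,z$ variables; for $\alpha\in\mathbb{N}^3$, $\mathrm{m}^\alpha=x^{\alpha_1}y^{\alpha_2}z^{\alpha_3}$. For $r\in S$,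 $W_r$ is the $\mathbb{K}$-vector space spanned by $\{\mathrm{m}^\alpha:\alpha\in\operatorname{F}(r,S)\}$ and $\delta_r=\dim_{\mathbb{K}}W_r$. *)

theory Defs
  imports Complex_Main "HOL-Library.Poly_Mapping" "HOL-Library.Product_Plus"
begin

text \<open>
  Exponent vectors live in \<open>\<int>\<^sup>3\<close>, with \<open>\<nat>\<^sup>3\<close> as a subset, so that
  the seed vector (which may have a negative first coordinate) and \<open>\<omega>\<close> have the same type as
  the factorizations.
\<close>

type_synonym int3 = "int \<times> int \<times> int"

definition Nat3 :: "int3 set" where
  "Nat3 = {(\<alpha>1, \<alpha>2, \<alpha>3). 0 \<le> \<alpha>1 \<and> 0 \<le> \<alpha>2 \<and> 0 \<le> \<alpha>3}"

fun smult3 :: "int \<Rightarrow> int3 \<Rightarrow> int3" (infixr "\<cdot>\<^sub>3" 75) where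
  "j \<cdot>\<^sub>3 (\<alpha>1, \<alpha>2, \<alpha>3) = (j * \<alpha>1, j * \<alpha>2, j * \<alpha>3)"

fun len3 :: "int3 \<Rightarrow> int" where
  "len3 (\<alpha>1, \<alpha>2, \<alpha>3) = \<alpha>1 + \<alpha>2 + \<alpha>3"

definition semigrp :: "nat \<Rightarrow> nat set" where
  "semigrp a = {\<alpha>1 * a + \<alpha>2 * (a + 1) + \<alpha>3 * (a + 2) |\<alpha>1 \<alpha>2 \<alpha>3. True}"

definition Fact :: "nat \<Rightarrow> nat \<Rightarrow> int3 set" where
  "Fact a r = {(\<alpha>1, \<alpha>2, \<alpha>3) \<in> Nat3.
     \<alpha>1 * int a + \<alpha>2 * (int a + 1) + \<alpha>3 * (int a + 2) = int r}"

definition Lengths :: "nat \<Rightarrow> nat \<Rightarrow> int set" where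
  "Lengths a r = len3 ` Fact a r"

definition Lbound :: "nat \<Rightarrow> nat" where
  "Lbound a = (if even a then (a div 2) * (a + 2) else (a div 2 + 2) * a)"

definition ell :: "nat \<Rightarrow> nat \<Rightarrow> nat" where
  "ell a r = r div a"

definition eps :: "nat \<Rightarrow> nat \<Rightarrow> nat" where
  "eps a r = r mod a"

definition seed :: "nat \<Rightarrow> nat \<Rightarrow> int3" where
  "seed a r =
     (int (ell a r) - (int (eps a r) + 1) div 2,
      int (eps a r) - 2 * (int (eps a r) div 2),
      int (eps a r) div 2)"

definition kappa :: "nat \<Rightarrow> nat \<Rightarrow> int" where
  "kappa a r = (case seed a r of (\<phi>1, \<phi>2, \<phi>3) \<Rightarrow> min \<phi>1 \<phi>3)"

definition iota :: "nat \<Rightarrow> nat \<Rightarrow> int" where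
  "iota a r = (case seed a r of (\<phi>1, \<phi>2, \<phi>3) \<Rightarrow> \<phi>2 + \<bar>\<phi>1 - \<phi>3\<bar>)"

definition omega :: int3 where
  "omega = (-1, 2, -1)"

text \<open>
  The polynomial ring \<open>K[x,y,z]\<close> is the monoid algebra of \<open>\<nat>\<^sup>3\<close>: finitely supported
  functions on exponent triples, with the convolution product of \<open>Poly_Mapping\<close>.
\<close>

type_synonym 'k poly3 = "(nat \<times> nat \<times> nat) \<Rightarrow>\<^sub>0 'k"

definition varX :: "'k::field poly3" where "varX = Poly_Mapping.single (1, 0, 0) 1"
definition varY :: "'k::field poly3" where "varY = Poly_Mapping.single (0, 1, 0) 1"
definition varZ :: "'k::field poly3" where "varZ = Poly_Mapping.single (0, 0, 1) 1"

definition pscale :: "'k::field \<Rightarrow> 'k poly3 \<Rightarrow> 'k poly3" where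
  "pscale c p = Poly_Mapping.single 0 c * p"

global_interpretation poly3: vector_space "pscale :: 'k::field \<Rightarrow> 'k poly3 \<Rightarrow> 'k poly3"
  by unfold_locales
    (simp_all add: pscale_def algebra_simps single_add mult_single flip: mult.assoc)

text \<open>Only meaningful on \<^const>\<open>Nat3\<close>, since \<^const>\<open>nat\<close> truncates negative exponents.\<close>

fun mono3 :: "int3 \<Rightarrow> 'k::field poly3" where
  "mono3 (\<alpha>1, \<alpha>2, \<alpha>3) = varX ^ nat \<alpha>1 * varY ^ nat \<alpha>2 * varZ ^ nat \<alpha>3"

definition Wspace :: "nat \<Rightarrow> nat \<Rightarrow> 'k::field poly3 set" where
  "Wspace a r = poly3.span (mono3 ` Fact a r)"

definition delta :: "'k::field itself \<Rightarrow> nat \<Rightarrow> nat \<Rightarrow> nat" where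
  "delta _ a r = poly3.dim (Wspace a r :: 'k poly3 set)"

definition Bbasis :: "nat \<Rightarrow> nat \<Rightarrow> 'k::field poly3 set" where
  "Bbasis a r = {mono3 (seed a r + j \<cdot>\<^sub>3 omega) |j. 0 \<le> j \<and> j \<le> kappa a r}"

end

theory Submission
  imports Defs
begin

text \<open>
  A factorization \<open>\<alpha>\<close> of \<open>r\<close> gives \<open>r = a u + v\<close> with \<open>u = |\<alpha>|\<close> and
  \<open>v = \<alpha>\<^sub>2 + 2 \<alpha>\<^sub>3 \<le> 2 u\<close>. Below \<open>\<L>\<^sub>a\<close> we have \<open>2 \<ell>\<^sub>r \<le> a + 1\<close>, and any
  \<open>u < \<ell>\<^sub>r\<close> would force \<open>a \<le> v \<le> 2 (\<ell>\<^sub>r - 1) < a\<close>. Hence \<open>|\<alpha>|\<close> and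
  \<open>\<alpha>\<^sub>2 + 2 \<alpha>\<^sub>3\<close> are determined by \<open>r\<close>, and \<open>\<alpha>\<close> runs over the lattice points of a
  line of direction \<open>\<omega>\<close> lying in \<open>\<nat>\<^sup>3\<close>.
\<close>

section \<open>Membership in the semigroup and the seed vector\<close>

lemma semigrp_iff_ex_au_v: "r \<in> semigrp a \<longleftrightarrow> (\<exists>u v. v \<le> 2 * u \<and> r = a * u + v)"
proof
  assume "r \<in> semigrp a"
  then obtain x y z where r: "r = x * a + y * (a + 1) + z * (a + 2)"
    by (auto simp: semigrp_def)
  have "y + 2 * z \<le> 2 * (x + y + z) \<and> r = a * (x + y + z) + (y + 2 * z)"
    unfolding r by (simp add: algebra_simps)
  then show "\<exists>u v. v \<le> 2 * u \<and> r = a * u + v" by blast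
next
  assume "\<exists>u v. v \<le> 2 * u \<and> r = a * u + v"
  then obtain u v where uv: "v \<le> 2 * u" "r = a * u + v" by blast
  \<comment> \<open>Taking \<open>y\<close> to be the parity of \<open>v\<close> makes
    \<open>y + z\<close> the ceiling of \<open>v / 2\<close>, the least value possible;
    \<open>v \<le> 2 * u\<close> then leaves room for a natural number \<open>x\<close>.\<close>
  define y z where "y = v mod 2" and "z = v div 2"
  have v: "v = y + 2 * z" by (simp add: y_def z_def)
  have "y + z \<le> u" using uv(1) unfolding y_def z_def by presburger
  then obtain x where u: "u = x + y + z" by (metis le_Suc_ex add.commute add.left_commute)
  have "r = x * a + y * (a + 1) + z * (a + 2)"
    unfolding uv(2) u v by (simp add: algebra_simps)
  then show "r \<in> semigrp a" unfolding semigrp_def by blast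
qed

text \<open>Dividing \<open>v\<close> by \<open>a\<close> carries \<open>v div a\<close> over to
  \<open>u\<close> and leaves the remainder of \<open>r\<close>. The first conclusion ensures that
  the subtraction in the second is not truncated.\<close>

lemma au_v_le_ell:
  assumes "a > 0" "r = a * u + v"
  shows "u \<le> ell a r" "v = a * (ell a r - u) + eps a r"
proof -
  have *: "ell a r = u + v div a" "eps a r = v mod a"
    using assms by (simp_all add: ell_def eps_def)
  show "u \<le> ell a r" "v = a * (ell a r - u) + eps a r"
    unfolding * by simp_all
qed

text \<open>Among all pairs with \<open>r = a * u + v\<close>, division with remainder has the
  largest \<open>u\<close> and the smallest \<open>v\<close>, so it satisfies
  \<open>v \<le> 2 * u\<close> as soon as any pair does.\<close>

lemma semigrp_iff_eps_le:
  assumes "a > 0"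
  shows "r \<in> semigrp a \<longleftrightarrow> eps a r \<le> 2 * ell a r"
proof
  assume "r \<in> semigrp a"
  then obtain u v where "v \<le> 2 * u" "r = a * u + v"
    unfolding semigrp_iff_ex_au_v by blast
  with au_v_le_ell[OF assms this(2)] show "eps a r \<le> 2 * ell a r" by linarith
next
  assume "eps a r \<le> 2 * ell a r"
  moreover have "r = a * ell a r + eps a r" by (simp add: ell_def eps_def)
  ultimately show "r \<in> semigrp a" unfolding semigrp_iff_ex_au_v by blast
qed

text \<open>Only the first coordinate can be negative, and it subtracts the ceiling of
  \<open>eps a r / 2\<close>.\<close>

lemma seed_in_Nat3_iff: "seed a r \<in> Nat3 \<longleftrightarrow> eps a r \<le> 2 * ell a r"
  unfolding seed_def Nat3_def by simp presburger

lemma len3_seed: "len3 (seed a r) = int (ell a r)"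
  by (simp add: seed_def)

lemma Fact_iff:
  "(x, y, z) \<in> Fact a r \<longleftrightarrow>
     (x, y, z) \<in> Nat3 \<and> int a * (x + y + z) + (y + 2 * z) = int r"
  by (auto simp: Fact_def algebra_simps)

lemma seed_in_Fact:
  assumes "seed a r \<in> Nat3"
  shows "seed a r \<in> Fact a r"
proof -
  define l e where "l = int (ell a r)" and "e = int (eps a r)"
  have r: "int r = int a * l + e"
    unfolding l_def e_def ell_def eps_def by (metis mult_div_mod_eq of_nat_add of_nat_mult)
  have s: "seed a r = (l - (e + 1) div 2, e - 2 * (e div 2), e div 2)"
    by (simp add: seed_def l_def e_def)
  \<comment> \<open>The floor and the ceiling of \<open>e / 2\<close> add up to
    \<open>e\<close>.\<close>
  have "l - (e + 1) div 2 + (e - 2 * (e div 2)) + e div 2 = l" by presburger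
  then show ?thesis using assms unfolding s Fact_iff r by simp
qed

section \<open>Factorizations below the bound\<close>

lemma ell_below_Lbound:
  assumes "a > 0" "r < Lbound a"
  shows "2 * ell a r \<le> a + 1"
proof (cases "even a")
  case True
  then obtain k where k: "a = 2 * k" by blast
  \<comment> \<open>\<open>k * (2 * k + 2) = (k + 1) * (2 * k)\<close>: in both parities the bound
    is a multiple of \<open>a\<close>, hence bounds the quotient.\<close>
  have "r < (k + 1) * a" using assms(2) by (simp add: Lbound_def k algebra_simps)
  then have "ell a r < k + 1" unfolding ell_def by (simp add: less_mult_imp_div_less)
  then show ?thesis using k by simp
next
  case False
  then obtain k where k: "a = 2 * k + 1" by (elim oddE)
  have "r < (k + 2) * a" using assms(2) by (simp add: Lbound_def k)
  then have "ell a r < k + 2" unfolding ell_def by (rule less_mult_imp_div_less)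
  then show ?thesis using k by simp
qed

lemma au_v_unique:
  assumes "a > 0" "r < Lbound a" "v \<le> 2 * u" "r = a * u + v"
  shows "u = ell a r" "v = eps a r"
proof -
  note le = au_v_le_ell[OF assms(1,4)]
  show u: "u = ell a r"
  proof (rule ccontr)
    assume "u \<noteq> ell a r"
    then have "1 \<le> ell a r - u" using le(1) by simp
    then have "a * 1 \<le> a * (ell a r - u)" by (rule mult_le_mono2)
    then show False
      using le(2) assms(3) ell_below_Lbound[OF assms(1,2)] \<open>1 \<le> ell a r - u\<close> by linarith
  qed
  show "v = eps a r" using le(2) by (simp add: u)
qed

lemma Fact_below_Lbound:
  assumes "a > 0" "r < Lbound a" "(x, y, z) \<in> Fact a r"
  shows "x + y + z = int (ell a r)" "y + 2 * z = int (eps a r)"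
proof -
  have nn: "0 \<le> x" "0 \<le> y" "0 \<le> z" and r: "int a * (x + y + z) + (y + 2 * z) = int r"
    using assms(3) by (auto simp: Fact_iff Nat3_def)
  \<comment> \<open>Both sums are nonnegative, so \<open>nat\<close> loses nothing and uniqueness
    over the naturals applies.\<close>
  define u v where "u = nat (x + y + z)" and "v = nat (y + 2 * z)"
  have uv: "int u = x + y + z" "int v = y + 2 * z" using nn by (simp_all add: u_def v_def)
  have "int r = int (a * u + v)" using r by (simp add: uv)
  then have "r = a * u + v" by (simp only: of_nat_eq_iff)
  moreover have "v \<le> 2 * u" using uv nn by linarith
  ultimately have "u = ell a r" "v = eps a r" using au_v_unique[OF assms(1,2)] by blast+
  then show "x + y + z = int (ell a r)" "y + 2 * z = int (eps a r)" using uv by simp_all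
qed

lemma seed_add_omega:
  "seed a r + j \<cdot>\<^sub>3 omega =
     (fst (seed a r) - j, fst (snd (seed a r)) + 2 * j, snd (snd (seed a r)) - j)"
  by (simp add: seed_def omega_def)

text \<open>Adding \<open>omega\<close> changes neither the length nor \<open>y + 2 * z\<close>; the
  range of \<open>j\<close> keeps the first and third coordinates nonnegative.\<close>

lemma seed_add_omega_in_Fact:
  assumes "seed a r \<in> Nat3" "0 \<le> j" "j \<le> kappa a r"
  shows "seed a r + j \<cdot>\<^sub>3 omega \<in> Fact a r"
proof -
  obtain p q s where pqs: "seed a r = (p, q, s)" by (metis prod_cases3)
  have "(p, q, s) \<in> Fact a r" using seed_in_Fact[OF assms(1)] pqs by simp
  then show ?thesis
    using assms(2,3) unfolding seed_add_omega Fact_iff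
    by (simp add: pqs kappa_def Nat3_def algebra_simps)
qed

lemma Fact_eq_seed_add_omega:
  assumes "a > 0" "r < Lbound a" "seed a r \<in> Nat3"
  shows "Fact a r = {seed a r + j \<cdot>\<^sub>3 omega |j. 0 \<le> j \<and> j \<le> kappa a r}"
proof (intro subset_antisym subsetI)
  fix \<alpha> assume \<alpha>: "\<alpha> \<in> Fact a r"
  obtain x y z where xyz: "\<alpha> = (x, y, z)" by (metis prod_cases3)
  note F = Fact_below_Lbound[OF assms(1,2) \<alpha>[unfolded xyz]]
  have nn: "0 \<le> x" "0 \<le> y" "0 \<le> z"
    using \<alpha> by (auto simp: xyz Fact_iff Nat3_def)
  \<comment> \<open>Each step along \<open>omega\<close> lowers the third coordinate by one, so
    \<open>j\<close> is the drop from the seed to \<open>z\<close>. The two fixed sums determine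
    \<open>x\<close> and \<open>y\<close>; nonnegativity of \<open>x\<close> and \<open>z\<close>
    gives \<open>j \<le> kappa a r\<close>.\<close>
  define j where "j = int (eps a r) div 2 - z"
  have "0 \<le> j" "x = int (ell a r) - (int (eps a r) + 1) div 2 - j"
    "y = int (eps a r) - 2 * (int (eps a r) div 2) + 2 * j"
    unfolding j_def F[symmetric] using nn by presburger+
  moreover have "z = int (eps a r) div 2 - j" by (simp add: j_def)
  ultimately have "\<alpha> = seed a r + j \<cdot>\<^sub>3 omega" "0 \<le> j" "j \<le> kappa a r"
    using nn unfolding xyz seed_add_omega by (simp_all add: seed_def kappa_def)
  then show "\<alpha> \<in> {seed a r + j \<cdot>\<^sub>3 omega |j. 0 \<le> j \<and> j \<le> kappa a r}" by blast
qed (use seed_add_omega_in_Fact[OF assms(3)] in auto)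

lemma Lengths_below_Lbound:
  assumes "a > 0" "r < Lbound a" "seed a r \<in> Nat3"
  shows "Lengths a r = {int (ell a r)}"
proof -
  have "len3 \<alpha> = int (ell a r)" if "\<alpha> \<in> Fact a r" for \<alpha>
    using that Fact_below_Lbound(1)[OF assms(1,2)] by (cases \<alpha>) auto
  then show ?thesis using seed_in_Fact[OF assms(3)] by (auto simp: Lengths_def)
qed

text \<open>The seed has length \<open>ell a r\<close>, and \<open>p + s\<close> is twice the
  minimum of \<open>p\<close> and \<open>s\<close> plus their distance.\<close>

lemma ell_eq_kappa_iota: "int (ell a r) = 2 * kappa a r + iota a r"
proof -
  obtain p q s where pqs: "seed a r = (p, q, s)" by (metis prod_cases3)
  show ?thesis
    using len3_seed[of a r] by (simp add: pqs kappa_def iota_def min_def abs_if)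
qed

section \<open>Monomials, linear independence and dimension\<close>

lemma single_power_one:
  fixes k :: "'a::comm_monoid_add"
  shows "Poly_Mapping.single k (1::'k::comm_semiring_1) ^ n =
    Poly_Mapping.single (((+) k ^^ n) 0) 1"
  by (induction n) (simp_all add: mult_single)

lemma mono3_eq_single:
  "mono3 (x, y, z) = Poly_Mapping.single (nat x, nat y, nat z) (1::'k::field)"
proof -
  have "((+) (1::nat, 0::nat, 0::nat) ^^ n) 0 = (n, 0, 0)"
    "((+) (0::nat, 1::nat, 0::nat) ^^ n) 0 = (0, n, 0)"
    "((+) (0::nat, 0::nat, 1::nat) ^^ n) 0 = (0, 0, n)" for n
    by (induction n) (simp_all add: zero_prod_def)
  then show ?thesis
    by (simp add: varX_def varY_def varZ_def single_power_one mult_single)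
qed

text \<open>The coefficient at the exponent of one monomial detects whether the other has the same
  exponent, and \<open>nat\<close> is injective on nonnegative integers.\<close>

lemma inj_on_mono3: "inj_on (mono3 :: int3 \<Rightarrow> 'k::field poly3) Nat3"
proof (rule inj_onI)
  fix \<alpha> \<beta> assume "\<alpha> \<in> Nat3" "\<beta> \<in> Nat3"
    and eq: "(mono3 \<alpha> :: 'k poly3) = mono3 \<beta>"
  obtain x y z x' y' z' where [simp]: "\<alpha> = (x, y, z)" "\<beta> = (x', y', z')"
    by (metis prod_cases3)
  have "Poly_Mapping.lookup (mono3 \<alpha> :: 'k poly3) (nat x, nat y, nat z) =
        Poly_Mapping.lookup (mono3 \<beta> :: 'k poly3) (nat x, nat y, nat z)"
    by (simp only: eq)
  then have "(nat x', nat y', nat z') = (nat x, nat y, nat z)"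
    by (simp add: mono3_eq_single lookup_single when_def del: mono3.simps split: if_splits)
  then show "\<alpha> = \<beta>" using \<open>\<alpha> \<in> Nat3\<close> \<open>\<beta> \<in> Nat3\<close> by (auto simp: Nat3_def)
qed

lemma independent_singles:
  "poly3.independent (range (\<lambda>k. Poly_Mapping.single k (1::'k::field)))"
  unfolding poly3.independent_explicit_module
proof (intro allI impI)
  fix t u and v :: "'k poly3"
  assume t: "finite t" "t \<subseteq> range (\<lambda>k. Poly_Mapping.single k 1)"
    and zero: "(\<Sum>w\<in>t. pscale (u w) w) = 0" and v: "v \<in> t"
  obtain k where k: "v = Poly_Mapping.single k 1" using t(2) v by blast
  \<comment> \<open>Distinct singles have distinct exponents, so in the vanishing combination only
    \<open>v\<close> contributes to the coefficient at \<open>k\<close>.\<close>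
  have "Poly_Mapping.lookup (pscale (u w) w) k = (if w = v then u w else 0)"
    if w: "w \<in> t" for w
  proof -
    obtain l where "w = Poly_Mapping.single l 1" using t(2) w by blast
    moreover from this have "w = v \<longleftrightarrow> l = k"
      unfolding k by (auto dest: arg_cong[where f = "\<lambda>p. Poly_Mapping.lookup p k"]
        simp: lookup_single when_def split: if_splits)
    ultimately show ?thesis
      by (simp only: pscale_def mult_single lookup_single when_def) simp
  qed
  then have "Poly_Mapping.lookup (\<Sum>w\<in>t. pscale (u w) w) k = (\<Sum>w\<in>t. if w = v then u w else 0)"
    by (simp add: lookup_sum)
  then show "u v = 0" using t(1) v by (simp add: zero)
qed

text \<open>Exponents outside \<open>Nat3\<close> may collapse under \<open>nat\<close>, but the
  image, being a set, still consists of distinct singles.\<close>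

lemma independent_mono3: "poly3.independent (mono3 ` A :: 'k::field poly3 set)"
proof (rule poly3.independent_mono[OF independent_singles])
  show "mono3 ` A \<subseteq> range (\<lambda>k. Poly_Mapping.single k (1::'k))"
    by (auto simp: mono3_eq_single simp del: mono3.simps)
qed

text \<open>The generators of \<open>Wspace a r\<close> are independent, and distinct factorizations
  give distinct monomials.\<close>

lemma delta_eq_card_Fact: "delta TYPE('k::field) a r = card (Fact a r)"
proof -
  have "Fact a r \<subseteq> Nat3" by (auto simp: Fact_def)
  then have "card (mono3 ` Fact a r :: 'k poly3 set) = card (Fact a r)"
    by (intro card_image inj_on_subset[OF inj_on_mono3])
  then show ?thesis
    by (simp add: delta_def Wspace_def poly3.dim_eq_card_independent independent_mono3)
qed

lemma card_Fact_below_Lbound: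
  assumes "a > 0" "r < Lbound a" "seed a r \<in> Nat3"
  shows "int (card (Fact a r)) = kappa a r + 1"
proof -
  have "Fact a r = (\<lambda>j. seed a r + j \<cdot>\<^sub>3 omega) ` {0..kappa a r}"
    unfolding Fact_eq_seed_add_omega[OF assms] by auto
  moreover have "inj_on (\<lambda>j. seed a r + j \<cdot>\<^sub>3 omega) {0..kappa a r}"
    by (rule inj_onI) (simp add: seed_add_omega)
  ultimately have "card (Fact a r) = card {0..kappa a r}" by (simp add: card_image)
  \<comment> \<open>The interval has \<open>nat (kappa a r + 1)\<close> elements; this excludes
    truncation.\<close>
  moreover have "0 \<le> kappa a r" using assms(3) by (auto simp: kappa_def Nat3_def)
  ultimately show ?thesis by simp
qed

theorem theorem3p1:
  fixes a r :: nat
  assumes "a \<ge> 3"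
  shows
    "(r \<in> semigrp a \<longleftrightarrow> eps a r \<le> 2 * ell a r) \<and>
     (r \<in> semigrp a \<longleftrightarrow> seed a r \<in> Nat3) \<and>
     (r \<in> semigrp a \<longleftrightarrow> (\<exists>u v :: nat. v \<le> 2 * u \<and> r = a * u + v)) \<and>
     (r \<in> semigrp a \<longrightarrow> seed a r \<in> Fact a r) \<and>
     (r \<in> semigrp a \<and> r < Lbound a \<longrightarrow>
        Lengths a r = {int (ell a r)} \<and>
        (\<forall>u v :: nat. v \<le> 2 * u \<and> r = a * u + v \<longrightarrow> (u, v) = (ell a r, eps a r)) \<and>
        Fact a r = {seed a r + j \<cdot>\<^sub>3 omega |j. 0 \<le> j \<and> j \<le> kappa a r} \<and>
        (poly3.independent (Bbasis a r :: 'k::field poly3 set) \<and>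
         poly3.span (Bbasis a r) = (Wspace a r :: 'k poly3 set) \<and>
         int (delta TYPE('k) a r) = kappa a r + 1) \<and>
        (int (ell a r) = 2 * (int (delta TYPE('k) a r) - 1) + iota a r \<and>
         (even (ell a r) \<longleftrightarrow> even (iota a r)) \<and>
         0 \<le> iota a r \<and> iota a r \<le> int (ell a r)))"
proof -
  have a: "a > 0" using assms by simp
  have S_eps: "r \<in> semigrp a \<longleftrightarrow> eps a r \<le> 2 * ell a r" by (rule semigrp_iff_eps_le[OF a])
  then have S_seed: "r \<in> semigrp a \<longleftrightarrow> seed a r \<in> Nat3" by (simp only: seed_in_Nat3_iff)
  have seed: "r \<in> semigrp a \<longrightarrow> seed a r \<in> Fact a r"
    using seed_in_Fact[of a r] S_seed by simp
  have below: "Lengths a r = {int (ell a r)} \<and>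
        (\<forall>u v :: nat. v \<le> 2 * u \<and> r = a * u + v \<longrightarrow> (u, v) = (ell a r, eps a r)) \<and>
        Fact a r = {seed a r + j \<cdot>\<^sub>3 omega |j. 0 \<le> j \<and> j \<le> kappa a r} \<and>
        (poly3.independent (Bbasis a r :: 'k poly3 set) \<and>
         poly3.span (Bbasis a r) = (Wspace a r :: 'k poly3 set) \<and>
         int (delta TYPE('k) a r) = kappa a r + 1) \<and>
        (int (ell a r) = 2 * (int (delta TYPE('k) a r) - 1) + iota a r \<and>
         (even (ell a r) \<longleftrightarrow> even (iota a r)) \<and>
         0 \<le> iota a r \<and> iota a r \<le> int (ell a r))"
    if "r \<in> semigrp a \<and> r < Lbound a"
  proof -
    have r: "r < Lbound a" and N: "seed a r \<in> Nat3" using that S_seed by auto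
    have F: "Fact a r = {seed a r + j \<cdot>\<^sub>3 omega |j. 0 \<le> j \<and> j \<le> kappa a r}"
      by (rule Fact_eq_seed_add_omega[OF a r N])
    \<comment> \<open>The family along \<open>omega\<close> is exactly the generating set of
      \<open>Wspace a r\<close>, so the spans agree by definition.\<close>
    have B: "Bbasis a r = (mono3 ` Fact a r :: 'k poly3 set)"
      unfolding F Bbasis_def by blast
    have d: "int (delta TYPE('k) a r) = kappa a r + 1"
      using card_Fact_below_Lbound[OF a r N] by (simp add: delta_eq_card_Fact)
    have nonneg: "0 \<le> kappa a r" "0 \<le> iota a r"
      using N by (auto simp: kappa_def iota_def Nat3_def)
    note l = ell_eq_kappa_iota[of a r]
    have "even (int (ell a r)) \<longleftrightarrow> even (iota a r)" by (simp add: l del: even_of_nat)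
    then have parity: "even (ell a r) \<longleftrightarrow> even (iota a r)" by simp
    have unique: "\<forall>u v. v \<le> 2 * u \<and> r = a * u + v \<longrightarrow> (u, v) = (ell a r, eps a r)"
      using au_v_unique[OF a r] by blast
    have basis: "poly3.independent (Bbasis a r :: 'k poly3 set)"
      "poly3.span (Bbasis a r) = (Wspace a r :: 'k poly3 set)"
      unfolding B Wspace_def by (rule independent_mono3 refl)+
    show ?thesis
      using Lengths_below_Lbound[OF a r N] unique F basis d l parity nonneg by simp
  qed
  show ?thesis using S_eps S_seed semigrp_iff_ex_au_v[of r a] seed below by blast
qed

end
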